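(* Let $\mathbb{D}$ be a division ring, $K\ge 1$ an integer, and $\mu_1:\mathbb{Z}\to\mathbb{D}^\times$ an arbitrary function, regarded as a function of $n_\sigma=n_1+\dots+n_N$. The non-commutative non-isospectral lattice modified Gel'fand--Dikii system $$(r_{k(j)}^{-1}-r_{k(i)}^{-1})\,r_{k(ij)} = r_{k+1}^{-1}(r_{k+1(i)}-r_{k+1(j)}),\quad k=1,\dots,K-1,$$ $$(r_{K(j)}^{-1}-r_{K(i)}^{-1})\,r_{K(ij)} = \mu_1^{-1}r_{1}^{-1}(r_{1(i)}-r_{1(j)})\,\mu_{1(\sigma)},\qquad i\neq j,$$ is three-dimensionally consistent. Explicitly: fix $s\in\mathbb{Z}$ (the value of $n_\sigma$ at the initial vertex), let $i,j,l$ be three distinct directions, and let $r_k,r_{k(i)},r_{k(j)},r_{k(l)}\in\mathbb{D}^\times$ ($k=1,\dots,K$) be such that for each $k$ the elements $r_{k(i)},r_{k(j)},r_{k(l)}$ are pairwise distinct. For distinct $a,b\in\{i,j,l\}$ let $r_{k(ab)}$ be defined by solving the system at the initial vertex, i.e. $$r_{k(ab)}=(r_{k(b)}^{-1}-r_{k(a)}^{-1})^{-1}r_{k+1}^{-1}(r_{k+1(a)}-r_{k+1(b)})\quad (1\le k\le K-1),$$ $$r_{K(ab)}=(r_{K(b)}^{-1}-r_{K(a)}^{-1})^{-1}\mu_1(s)^{-1}r_{1}^{-1}(r_{1(a)}-r_{1(b)})\mu_1(s+1),$$ and assume that for each $k$ the elements $r_{k(ij)},r_{k(il)},r_{k(jl)}$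 are pairwise distinct. For $\{a,b,c\}=\{i,j,l\}$ let $$[r_{k(ab)}]_{(c)}=(r_{k(bc)}^{-1}-r_{k(ac)}^{-1})^{-1}r_{k+1(c)}^{-1}(r_{k+1(ac)}-r_{k+1(bc)})\quad (1\le k\le K-1),$$ $$[r_{K(ab)}]_{(c)}=(r_{K(bc)}^{-1}-r_{K(ac)}^{-1})^{-1}\mu_1(s+1)^{-1}r_{1(c)}^{-1}(r_{1(ac)}-r_{1(bc)})\mu_1(s+2).$$ Then $[r_{k(ij)}]_{(l)}=[r_{k(il)}]_{(j)}=[r_{k(jl)}]_{(i)}$ for every $k=1,\dots,K$.
   Context: For a function $f$ on $\mathbb{Z}^N$, $f_{(i)}$ denotes the translate $n_i\mapsto n_i+1$, and $f_{(ij)}=(f_{(i)})_{(j)}$. For a function $g$ of $n_\sigma=n_1+\dots+n_N$, $g_{(\sigma)}(n_\sigma)=g(n_\sigma+1)$. The unknowns of the system are $r_1,\dots,r_K:\mathbb{Z}^N\to\mathbb{D}^\times=\mathbb{D}\setminus\{0\}$. Three-dimensional consistency means that on an elementary cube of $\mathbb{Z}^3$, given generic values at a vertex and at its three neighbours, the values at the vertices with two shifts are determined by the system on the three faces containing the initial vertex, and the three ways to calculate the values at the opposite vertex (using the system on the three other faces) agree. "Generic" means that all expressions occurring are defined. *)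

theory Defs
  imports Complex_Main
begin

text \<open>
  A family \<open>r\<^sub>1, \<dots>, r\<^sub>K\<close> at one lattice vertex is a function \<open>nat \<Rightarrow> 'a\<close>, of which only the values on
  \<open>{1..K}\<close> matter. The arguments \<open>r\<close>, \<open>ra\<close>, \<open>rb\<close>, \<open>rab\<close> are the values at the vertices of
  an elementary face: the initial one, its shifts in the directions \<open>a\<close> and \<open>b\<close>, and the double
  shift; \<open>s\<close> is the value of \<open>n\<^sub>\<sigma>\<close> at the initial vertex, so that \<open>\<mu> (s + 1)\<close> is the shift
  \<open>\<mu>\<^bsub>(\<sigma>)\<^esub>\<close> of \<open>\<mu> s\<close>.
\<close>

definition lmGD_face ::
  "nat \<Rightarrow> (int \<Rightarrow> 'a::division_ring) \<Rightarrow> int \<Rightarrow>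
    (nat \<Rightarrow> 'a) \<Rightarrow> (nat \<Rightarrow> 'a) \<Rightarrow> (nat \<Rightarrow> 'a) \<Rightarrow> (nat \<Rightarrow> 'a) \<Rightarrow> bool" where
  "lmGD_face K \<mu> s r ra rb rab \<longleftrightarrow>
    (\<forall>k\<in>{1..<K}.
      (inverse (rb k) - inverse (ra k)) * rab k = inverse (r (k + 1)) * (ra (k + 1) - rb (k + 1))) \<and>
    (inverse (rb K) - inverse (ra K)) * rab K =
      inverse (\<mu> s) * inverse (r 1) * (ra 1 - rb 1) * \<mu> (s + 1)"

text \<open>The same equations solved for \<open>rab k\<close>, for \<open>1 \<le> k \<le> K\<close>.\<close>

definition lmGD_solve ::
  "nat \<Rightarrow> (int \<Rightarrow> 'a::division_ring) \<Rightarrow> int \<Rightarrow>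
    (nat \<Rightarrow> 'a) \<Rightarrow> (nat \<Rightarrow> 'a) \<Rightarrow> (nat \<Rightarrow> 'a) \<Rightarrow> nat \<Rightarrow> 'a" where
  "lmGD_solve K \<mu> s r ra rb k =
    (if k < K
     then inverse (inverse (rb k) - inverse (ra k)) * inverse (r (k + 1)) * (ra (k + 1) - rb (k + 1))
     else inverse (inverse (rb K) - inverse (ra K)) *
       inverse (\<mu> s) * inverse (r 1) * (ra 1 - rb 1) * \<mu> (s + 1))"

end

theory Submission imports Defs begin

text \<open>
  With \<open>d a b\<close> denoting the divided difference of a vertex function \<open>u\<close> with respect to the next
  component \<open>p = r\<^bsub>k+1\<^esub>\<close>, the inverse of \<open>r\<^bsub>k(ab)\<^esub>\<close> is, up to a factor \<open>\<mu>\<close>, minus \<open>d a b\<close> for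
  \<open>u = r\<^bsub>k+1\<^esub> r\<^sub>k\<^sup>-\<^sup>1\<close> (the first factor unshifted). Both the denominator and the numerator of
  \<open>[r\<^bsub>k(ab)\<^esub>]\<^bsub>(c)\<^esub>\<close> are then second differences \<open>X c\<close> obeying the same exchange rule
  \<open>(p a - p c) X c = (p a - p b) X b\<close>, so that their left quotient does not depend on the choice
  of the last direction.
\<close>

text \<open>Together with \<open>wrap_factor\<close> this merges the ordinary equations and the
  closing one into a single cyclic formula: \<open>\<mu>\<close> enters only on the wrap from
  \<open>K\<close> to 1.\<close>

definition cyc_succ :: "nat \<Rightarrow> nat \<Rightarrow> nat" where
  "cyc_succ K k = (if k < K then k + 1 else 1)"

definition wrap_factor :: "nat \<Rightarrow> (int \<Rightarrow> 'a::division_ring) \<Rightarrow> nat \<Rightarrow> int \<Rightarrow> 'a" where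
  "wrap_factor K \<mu> k t = (if k < K then 1 else \<mu> t)"

lemma cyc_succ_range: "1 \<le> K \<Longrightarrow> cyc_succ K k \<in> {1..K}"
  by (auto simp: cyc_succ_def)

lemma wrap_factor_nonzero: "(\<And>n. \<mu> n \<noteq> 0) \<Longrightarrow> wrap_factor K \<mu> k t \<noteq> 0"
  by (simp add: wrap_factor_def)

lemma lmGD_solve_eq:
  assumes "k \<le> K"
  shows "lmGD_solve K \<mu> s r ra rb k =
    inverse (inverse (rb k) - inverse (ra k)) *
      (inverse (wrap_factor K \<mu> k s) * inverse (r (cyc_succ K k)) *
        (ra (cyc_succ K k) - rb (cyc_succ K k)) * wrap_factor K \<mu> k (s + 1))"
  using assms by (auto simp: lmGD_solve_def cyc_succ_def wrap_factor_def mult.assoc)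

text \<open>Interchanging the directions flips the sign of both differences, and the two signs
  cancel because -1 is central.\<close>

lemma lmGD_solve_commute:
  "lmGD_solve K \<mu> s r ra rb k = lmGD_solve K \<mu> s r rb ra k"
proof -
  have swap: "inverse (x - y) * u * (v - w) = inverse (y - x) * u * (w - v)" for u v w x y :: 'a
  proof -
    have "inverse (- d) * u * - e = inverse d * u * e" for d e :: 'a
      by simp
    from this[of "y - x" "w - v"] show ?thesis
      by (simp only: minus_diff_eq)
  qed
  have swap': "inverse (x - y) * t * u * (v - w) = inverse (y - x) * t * u * (w - v)"
    for t u v w x y :: 'a
    using swap[of x y "t * u"] by (simp only: mult.assoc)
  show ?thesis
    unfolding lmGD_solve_def
    by (cases "k < K")
      (simp_all only: if_True if_False simp_thms swap[of "inverse (rb k)"] swap'[of "inverse (rb K)"])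
qed

text \<open>Injectivity of \<open>inverse\<close> turns distinctness of the neighbours into
  invertibility of the coefficient, so each equation determines the fourth vertex.\<close>

lemma lmGD_face_iff_solve:
  assumes "1 \<le> K" and "\<And>k. k \<in> {1..K} \<Longrightarrow> ra k \<noteq> rb k"
  shows "lmGD_face K \<mu> s r ra rb x \<longleftrightarrow> (\<forall>k\<in>{1..K}. x k = lmGD_solve K \<mu> s r ra rb k)"
proof -
  have solve: "d * y = z \<longleftrightarrow> y = inverse d * z" if "d \<noteq> 0" for d y z :: 'a
    using that by (metis left_inverse right_inverse mult.assoc mult_1_left)
  have nz: "inverse (rb k) - inverse (ra k) \<noteq> 0" if "k \<in> {1..K}" for k
    using assms(2)[OF that] by (metis eq_iff_diff_eq_0 inverse_inverse_eq)
  have "{1..K} = insert K {1..<K}"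
    using assms(1) by auto
  then show ?thesis
    unfolding lmGD_face_def
    using nz by (auto simp: lmGD_solve_def solve mult.assoc)
qed

text \<open>The convention \<open>inverse 0 = 0\<close> covers vanishing factors, so second
  differences can be inverted below without discussing whether they are zero.\<close>

lemma inverse_mult_swap:
  fixes x y :: "'a::division_ring"
  shows "inverse (x * y) = inverse y * inverse x"
  by (cases "x = 0 \<or> y = 0") (auto simp: nonzero_inverse_mult_distrib)

text \<open>Prepares the denominator of the next solve: the factor at \<open>s + 1\<close> moves to
  the far left, where it is common to both terms.\<close>

lemma inverse_lmGD_solve:
  assumes "k \<le> K"
  shows "inverse (lmGD_solve K \<mu> s r ra rb k) =
    inverse (wrap_factor K \<mu> k (s + 1)) *
      (inverse (ra (cyc_succ K k) - rb (cyc_succ K k)) *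
        (r (cyc_succ K k) * wrap_factor K \<mu> k s * (inverse (rb k) - inverse (ra k))))"
  by (simp add: lmGD_solve_eq[OF assms] inverse_mult_swap mult.assoc)

text \<open>Prepares the numerator of the next solve. From b^-1 - a^-1 = a^-1 (a - b) b^-1, the
  inverted coefficient is b (a - b)^-1 a, and its leading b is cancelled by the prefactor; a slope
  with weight a remains.\<close>

lemma inverse_mult_lmGD_solve:
  assumes "k \<le> K" "ra k \<noteq> 0" "rb k \<noteq> 0"
  shows "inverse (rb k) * lmGD_solve K \<mu> s r ra rb k =
    inverse (ra k - rb k) * ra k *
      (inverse (wrap_factor K \<mu> k s) * inverse (r (cyc_succ K k)) *
        (ra (cyc_succ K k) - rb (cyc_succ K k))) * wrap_factor K \<mu> k (s + 1)"
proof -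
  have "inverse (rb k) - inverse (ra k) = inverse (ra k) * (ra k - rb k) * inverse (rb k)"
    using assms(2,3) by (simp add: algebra_simps)
  then have "inverse (inverse (rb k) - inverse (ra k)) = rb k * (inverse (ra k - rb k) * ra k)"
    by (simp add: inverse_mult_swap mult.assoc)
  then show ?thesis
    using assms by (simp add: lmGD_solve_eq mult.assoc[symmetric])
qed

text \<open>Here \<open>u\<close>, \<open>v\<close>, \<open>w\<close> are values at the nodes
  \<open>p\<close>, \<open>q\<close>, \<open>t\<close>. Splitting \<open>p - t\<close> at
  \<open>q\<close> reduces both sides to \<open>(p - q) * g - (v - u)\<close>, where the slope
  \<open>g\<close> is symmetric in \<open>q\<close> and \<open>t\<close>.\<close>

lemma exchange_divided_difference:
  fixes p q t :: "'a::division_ring"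
  assumes "p \<noteq> q" "p \<noteq> t" "q \<noteq> t"
  shows "(p - t) * (inverse (q - t) * (w - v) - inverse (p - t) * (w - u)) =
    (p - q) * (inverse (t - q) * (v - w) - inverse (p - q) * (v - u))"
proof -
  define g where "g = inverse (q - t) * (w - v)"
  have g: "(q - t) * g = w - v"
    using assms by (simp add: g_def mult.assoc[symmetric])
  have g': "inverse (t - q) * (v - w) = g"
    unfolding g_def by (metis inverse_minus_eq minus_diff_eq minus_mult_commute minus_mult_left)
  have "(p - t) * (g - inverse (p - t) * (w - u)) = (p - t) * g - (w - u)"
    using assms by (simp add: right_diff_distrib mult.assoc[symmetric])
  also have "\<dots> = (p - q) * g + (q - t) * g - (w - u)"
    by (simp add: algebra_simps)
  also have "\<dots> = (p - q) * g - (v - u)"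
    by (simp add: g)
  also have "\<dots> = (p - q) * (g - inverse (p - q) * (v - u))"
    using assms by (simp add: right_diff_distrib mult.assoc[symmetric])
  finally show ?thesis
    by (simp add: g' flip: g_def)
qed

lemma exchange_weighted_difference:
  fixes p q t :: "'a::division_ring"
  assumes "p \<noteq> q" "p \<noteq> t" "q \<noteq> t"
  shows "(p - t) * (inverse (p - t) * p * (u - w) - inverse (q - t) * q * (v - w)) =
    (p - q) * (inverse (p - q) * p * (u - v) - inverse (t - q) * t * (w - v))"
proof -
  define h where "h = inverse (q - t) * q * (v - w)"
  have h: "(q - t) * h = q * (v - w)"
    using assms by (simp add: h_def mult.assoc[symmetric])
  \<comment> \<open>The weighted slope is not symmetric: writing the weight \<open>q\<close> as
    \<open>t + (q - t)\<close> shows that exchanging the nodes costs exactly \<open>v - w\<close>.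
    This defect turns \<open>u - w\<close> into \<open>u - v\<close> below.\<close>
  have h': "inverse (t - q) * t * (w - v) = h - (v - w)"
  proof -
    have "(t - q) * (h - (v - w)) = t * (w - v)"
      using h by (simp add: algebra_simps)
    then have "inverse (t - q) * t * (w - v) = inverse (t - q) * (t - q) * (h - (v - w))"
      by (simp only: mult.assoc)
    then show ?thesis
      using assms(3) by simp
  qed
  have "(p - t) * (inverse (p - t) * p * (u - w) - h) = p * (u - w) - (p - t) * h"
    using assms by (simp add: right_diff_distrib[of "p - t"] mult.assoc[symmetric])
  also have "\<dots> = p * (u - w) - (p - q) * h - (q - t) * h"
    by (simp add: algebra_simps)
  also have "\<dots> = p * (u - v) - (p - q) * (h - (v - w))"
    by (simp add: h) (simp add: algebra_simps)
  also have "\<dots> = (p - q) * (inverse (p - q) * p * (u - v) - (h - (v - w)))"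
    using assms by (simp add: right_diff_distrib[of "p - q"] mult.assoc[symmetric])
  finally show ?thesis
    by (simp add: h' flip: h_def)
qed

text \<open>A left quotient is unchanged when both entries get a common invertible left factor; here
  the factors are \<open>x\<close> and \<open>y\<close>.\<close>

lemma left_quotient_eq:
  fixes x y :: "'a::division_ring"
  assumes "x \<noteq> 0" "y \<noteq> 0" "x * e = y * e'" "x * d = y * d'"
  shows "inverse e * d = inverse e' * d'"
proof -
  have "inverse e * d = inverse (x * e) * (x * d)"
    using assms(1) by (simp add: inverse_mult_swap mult.assoc) (simp add: mult.assoc[symmetric])
  also have "\<dots> = inverse e' * d'"
    using assms(2) unfolding assms(3,4)
    by (simp add: inverse_mult_swap mult.assoc) (simp add: mult.assoc[symmetric])
  finally show ?thesis .
qed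

text \<open>One transposition of the last direction, between \<open>c\<close> and \<open>b\<close>;
  two such transpositions give the whole consistency.\<close>

lemma lmGD_solve_exchange:
  assumes K: "1 \<le> K" "k \<le> K" and \<mu>: "\<And>n. \<mu> n \<noteq> 0"
    and nz: "\<And>k. k \<in> {1..K} \<Longrightarrow> ra k \<noteq> 0 \<and> rb k \<noteq> 0 \<and> rc k \<noteq> 0"
    and dist: "\<And>k. k \<in> {1..K} \<Longrightarrow> distinct [ra k, rb k, rc k]"
    and ac: "\<And>k. k \<in> {1..K} \<Longrightarrow> rac k = lmGD_solve K \<mu> s r ra rc k"
    and bc: "\<And>k. k \<in> {1..K} \<Longrightarrow> rbc k = lmGD_solve K \<mu> s r rb rc k"
    and ab: "\<And>k. k \<in> {1..K} \<Longrightarrow> rab k = lmGD_solve K \<mu> s r ra rb k"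
    and k: "1 \<le> k"
  shows "lmGD_solve K \<mu> (s + 1) rc rac rbc k = lmGD_solve K \<mu> (s + 1) rb rab rbc k"
proof -
  define k' where "k' = cyc_succ K k"
  have k': "k' \<in> {1..K}" "k' \<le> K"
    using cyc_succ_range[OF K(1), of k] by (auto simp: k'_def)
  \<comment> \<open>The same vertex value read in the other order, so that \<open>solve\<close> also
    applies with \<open>b\<close> as last direction.\<close>
  have cb: "rbc k = lmGD_solve K \<mu> s r rc rb k" if "k \<in> {1..K}" for k
    using bc[OF that] lmGD_solve_commute[of K \<mu> s r rb] by simp
  define m where "m = wrap_factor K \<mu> k (s + 1)"
  define n where "n = wrap_factor K \<mu> k' (s + 1)"
  define R where "R = r k' * wrap_factor K \<mu> k s"
  define S where "S = inverse (wrap_factor K \<mu> k' s) * inverse (r (cyc_succ K k'))"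
  have m: "m \<noteq> 0"
    using \<mu> by (simp add: m_def wrap_factor_nonzero)
  have pq: "ra k' \<noteq> rb k'" "ra k' \<noteq> rc k'" "rb k' \<noteq> rc k'"
    using dist[OF k'(1)] by auto
  \<comment> \<open>\<open>E\<close> and \<open>D\<close> have the shapes of the two exchange
    lemmas, with nodes taken from component \<open>k'\<close>. The left factors \<open>R\<close> and
    \<open>S\<close> live at the initial vertex and thus are the same for all directions.\<close>
  define E where "E x y z = inverse (y k' - z k') * (R * inverse (z k) - R * inverse (y k)) -
    inverse (x k' - z k') * (R * inverse (z k) - R * inverse (x k))" for x y z :: "nat \<Rightarrow> 'a"
  define D where "D x y z = inverse (x k' - z k') * x k' * (S * x (cyc_succ K k') - S * z (cyc_succ K k')) -
    inverse (y k' - z k') * y k' * (S * y (cyc_succ K k') - S * z (cyc_succ K k'))"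
    for x y z :: "nat \<Rightarrow> 'a"
  have solve: "lmGD_solve K \<mu> (s + 1) z xz yz k =
      inverse (E x y z) * D x y z * (n * wrap_factor K \<mu> k (s + 2))"
    if "x k' \<noteq> 0" "y k' \<noteq> 0" "z k' \<noteq> 0"
      and xz: "\<And>k. k \<in> {1..K} \<Longrightarrow> xz k = lmGD_solve K \<mu> s r x z k"
      and yz: "\<And>k. k \<in> {1..K} \<Longrightarrow> yz k = lmGD_solve K \<mu> s r y z k"
    for x y z xz yz :: "nat \<Rightarrow> 'a"
  proof -
    have kK: "k \<in> {1..K}"
      using K k by simp
    have den: "inverse (yz k) - inverse (xz k) = inverse m * E x y z"
      unfolding xz[OF kK] yz[OF kK] inverse_lmGD_solve[OF K(2)]
      by (simp add: E_def R_def m_def k'_def right_diff_distrib)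
    have "inverse (z k') * (xz k' - yz k') = D x y z * n"
      unfolding xz[OF k'(1)] yz[OF k'(1)] right_diff_distrib[of "inverse (z k')"]
      using that(1-3)
      by (simp add: inverse_mult_lmGD_solve k'(2) D_def S_def n_def left_diff_distrib
          right_diff_distrib[of "_ * _"])
    then have "lmGD_solve K \<mu> (s + 1) z xz yz k =
        inverse (inverse m * E x y z) * (inverse m * (D x y z * n) * wrap_factor K \<mu> k (s + 2))"
      using lmGD_solve_eq[OF K(2), of \<mu> "s + 1" z xz yz]
      by (simp add: den k'_def[symmetric] m_def[symmetric] mult.assoc[of "inverse m"] add.assoc)
    \<comment> \<open>The \<open>m\<close> left by the first-level solutions meets the
      \<open>inverse m\<close> of the second-level equation. Both are taken at \<open>s + 1\<close>,
      which is why a varying \<open>\<mu>\<close> does no harm.\<close>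
    also have "\<dots> = inverse (E x y z) * (m * inverse m) * D x y z * (n * wrap_factor K \<mu> k (s + 2))"
      by (simp only: inverse_mult_swap inverse_inverse_eq mult.assoc)
    finally show ?thesis
      using m by simp
  qed
  have "inverse (E ra rb rc) * D ra rb rc = inverse (E ra rc rb) * D ra rc rb"
  proof (rule left_quotient_eq)
    show "ra k' - rc k' \<noteq> 0" "ra k' - rb k' \<noteq> 0"
      using pq by auto
    show "(ra k' - rc k') * E ra rb rc = (ra k' - rb k') * E ra rc rb"
      unfolding E_def by (rule exchange_divided_difference) (use pq in auto)
    show "(ra k' - rc k') * D ra rb rc = (ra k' - rb k') * D ra rc rb"
      unfolding D_def by (rule exchange_weighted_difference) (use pq in auto)
  qed
  then show ?thesis
    using solve[of ra rb rc rac rbc, OF _ _ _ ac bc] solve[of ra rc rb rab rbc, OF _ _ _ ab cb]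
      nz[OF k'(1)] by simp
qed

theorem proposition4p3:
  fixes K :: nat
    and \<mu> :: "int \<Rightarrow> 'a::division_ring"
    and s :: int
    and i j l :: 'd
    and r :: "nat \<Rightarrow> 'a"
    and r1 :: "'d \<Rightarrow> nat \<Rightarrow> 'a"
    and r2 :: "'d \<Rightarrow> 'd \<Rightarrow> nat \<Rightarrow> 'a"
  assumes "K \<ge> 1"
    and "\<And>n. \<mu> n \<noteq> 0"
    and "distinct [i, j, l]"
    and "\<And>k. k \<in> {1..K} \<Longrightarrow> r k \<noteq> 0"
    and "\<And>k a. k \<in> {1..K} \<Longrightarrow> a \<in> {i, j, l} \<Longrightarrow> r1 a k \<noteq> 0"
    and "\<And>k. k \<in> {1..K} \<Longrightarrow> distinct [r1 i k, r1 j k, r1 l k]"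
    and "\<And>k a b. k \<in> {1..K} \<Longrightarrow> a \<in> {i, j, l} \<Longrightarrow> b \<in> {i, j, l} \<Longrightarrow> a \<noteq> b \<Longrightarrow>
           r2 a b k = lmGD_solve K \<mu> s r (r1 a) (r1 b) k"
    and "\<And>k. k \<in> {1..K} \<Longrightarrow> distinct [r2 i j k, r2 i l k, r2 j l k]"
  shows
    "(\<forall>a\<in>{i, j, l}. \<forall>b\<in>{i, j, l}. a \<noteq> b \<longrightarrow>
        (\<forall>x. lmGD_face K \<mu> s r (r1 a) (r1 b) x \<longleftrightarrow> (\<forall>k\<in>{1..K}. x k = r2 a b k))) \<and>
     (\<forall>a b c. {a, b, c} = {i, j, l} \<longrightarrow>
        (\<forall>x. lmGD_face K \<mu> (s + 1) (r1 c) (r2 a c) (r2 b c) x \<longleftrightarrow>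
          (\<forall>k\<in>{1..K}. x k = lmGD_solve K \<mu> (s + 1) (r1 c) (r2 a c) (r2 b c) k))) \<and>
     (\<forall>k\<in>{1..K}.
        lmGD_solve K \<mu> (s + 1) (r1 l) (r2 i l) (r2 j l) k =
          lmGD_solve K \<mu> (s + 1) (r1 j) (r2 i j) (r2 l j) k \<and>
        lmGD_solve K \<mu> (s + 1) (r1 j) (r2 i j) (r2 l j) k =
          lmGD_solve K \<mu> (s + 1) (r1 i) (r2 j i) (r2 l i) k)"
proof -
  have sym: "r2 a b k = r2 b a k" if "k \<in> {1..K}" "a \<in> {i, j, l}" "b \<in> {i, j, l}" for a b k
    using assms(7)[of k a b] assms(7)[of k b a] lmGD_solve_commute[of K \<mu> s r "r1 a"] that by (cases "a = b") auto
  have r1_ne: "r1 a k \<noteq> r1 b k" if "k \<in> {1..K}" "a \<in> {i, j, l}" "b \<in> {i, j, l}" "a \<noteq> b" for a b k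
    using assms(6)[OF that(1)] that(2-4) by auto
  have r2_ne: "r2 a c k \<noteq> r2 b c k" if "k \<in> {1..K}" "{a, b, c} = {i, j, l}" for a b c k
  proof -
    \<comment> \<open>Counting extracts pairwise distinctness from the bare equality of
      sets.\<close>
    have "card {a, b, c} = 3"
      using that(2) assms(3) by simp
    then have "a \<noteq> b" "a \<noteq> c" "b \<noteq> c"
      by (auto simp: card_insert_if split: if_splits)
    moreover have "a \<in> {i, j, l}" "b \<in> {i, j, l}" "c \<in> {i, j, l}"
      using that(2) by auto
    ultimately show ?thesis
      using assms(8)[OF that(1)] sym[OF that(1), of i j] sym[OF that(1), of i l]
        sym[OF that(1), of j l] by auto
  qed
  have exchange: "lmGD_solve K \<mu> (s + 1) (r1 c) (r2 a c) (r2 b c) k =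
      lmGD_solve K \<mu> (s + 1) (r1 b) (r2 a b) (r2 c b) k"
    if "k \<in> {1..K}" "a \<in> {i, j, l}" "b \<in> {i, j, l}" "c \<in> {i, j, l}" "distinct [a, b, c]" for a b c k
  proof -
    have "lmGD_solve K \<mu> (s + 1) (r1 c) (r2 a c) (r2 b c) k =
      lmGD_solve K \<mu> (s + 1) (r1 b) (r2 a b) (r2 b c) k"
      by (rule lmGD_solve_exchange[of K k \<mu> "r1 a" "r1 b" "r1 c" "r2 a c" s r "r2 b c" "r2 a b"])
        (use that assms r1_ne in auto)
    also have "\<dots> = lmGD_solve K \<mu> (s + 1) (r1 b) (r2 a b) (r2 c b) k"
      using that cyc_succ_range[OF assms(1), of k] sym[of _ b c] by (simp add: lmGD_solve_eq)
    finally show ?thesis .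
  qed
  show ?thesis
  proof (intro conjI ballI allI impI)
    fix a b x
    assume ab: "a \<in> {i, j, l}" "b \<in> {i, j, l}" "a \<noteq> b"
    show "lmGD_face K \<mu> s r (r1 a) (r1 b) x \<longleftrightarrow> (\<forall>k\<in>{1..K}. x k = r2 a b k)"
      using lmGD_face_iff_solve[OF assms(1), of "r1 a" "r1 b"] r1_ne[OF _ ab] assms(7)[OF _ ab]
      by simp
  next
    fix a b c x
    assume "{a, b, c} = {i, j, l}"
    then show "lmGD_face K \<mu> (s + 1) (r1 c) (r2 a c) (r2 b c) x \<longleftrightarrow>
        (\<forall>k\<in>{1..K}. x k = lmGD_solve K \<mu> (s + 1) (r1 c) (r2 a c) (r2 b c) k)"
      using r2_ne by (intro lmGD_face_iff_solve assms(1))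
  next
    fix k
    assume k: "k \<in> {1..K}"
    show "lmGD_solve K \<mu> (s + 1) (r1 l) (r2 i l) (r2 j l) k =
        lmGD_solve K \<mu> (s + 1) (r1 j) (r2 i j) (r2 l j) k"
      using exchange[OF k, of i j l] assms(3) by simp
    \<comment> \<open>With \<open>l\<close> in the first role the exchange yields the doubly shifted
      arguments in reversed order; symmetry of the solved form restores it.\<close>
    have "lmGD_solve K \<mu> (s + 1) (r1 j) (r2 l j) (r2 i j) k =
        lmGD_solve K \<mu> (s + 1) (r1 i) (r2 l i) (r2 j i) k"
      using exchange[OF k, of l i j] assms(3) by auto
    then show "lmGD_solve K \<mu> (s + 1) (r1 j) (r2 i j) (r2 l j) k =
        lmGD_solve K \<mu> (s + 1) (r1 i) (r2 j i) (r2 l i) k"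
      by (simp add: lmGD_solve_commute[of _ _ _ _ "r2 l _"])
  qed
qed

end
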